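(* Let $\mathbb{S}=\{(x,y)\in\mathbb{R}^2: x^2+y^2=1\}$. There exists a decreasing sequence $\{\lambda_n\}_{n\in\mathbb{N}}$ in $(0,1/2)$ with $\lambda_n\to 2-\sqrt{3}$ as $n\to\infty$ such that $\mathbb{S}\cap(K_{\lambda_n}\times K_{\lambda_n})$ is non-trivial for all $n\in\mathbb{N}$.
   Context: $\mathbb{N}$ is the set of positive integers. For $\lambda\in(0,1/2)$, $K_\lambda\subset\mathbb{R}$ is the self-similar set generated by the iterated function system $\{f_0(x)=\lambda x,\ f_1(x)=\lambda x+1-\lambda\}$, i.e. the unique nonempty compact set with $K_\lambda=f_0(K_\lambda)\cup f_1(K_\lambda)$. The intersection $\mathbb{S}\cap(K_\lambda\times K_\lambda)$ is called trivial if it equals $\{(0,1),(1,0)\}$, and non-trivial otherwise (the points $(0,1)$ and $(1,0)$ always belong to it). *)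

theory Defs
  imports "HOL-Analysis.Analysis"
begin

definition f\<^sub>0 :: "real \<Rightarrow> real \<Rightarrow> real" where
  "f\<^sub>0 l x = l * x"

definition f\<^sub>1 :: "real \<Rightarrow> real \<Rightarrow> real" where
  "f\<^sub>1 l x = l * x + 1 - l"

text \<open>Well defined for \<open>0 < l < 1/2\<close> by \<open>cantor_set_ex1\<close> below.\<close>

definition cantor_set :: "real \<Rightarrow> real set" where
  "cantor_set l = (THE K. compact K \<and> K \<noteq> {} \<and> K = f\<^sub>0 l ` K \<union> f\<^sub>1 l ` K)"

definition unit_circle :: "(real \<times> real) set" where
  "unit_circle = {(x, y). x\<^sup>2 + y\<^sup>2 = 1}"

definition trivial_intersection :: "real \<Rightarrow> bool" where
  "trivial_intersection l \<longleftrightarrow>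
     unit_circle \<inter> (cantor_set l \<times> cantor_set l) = {(0, 1), (1, 0)}"

lemma invariant_subset:
  fixes K L :: "real set"
  assumes l: "0 < l" "l < 1/2"
    and K: "compact K" "K \<noteq> {}" "K = f\<^sub>0 l ` K \<union> f\<^sub>1 l ` K"
    and L: "compact L" "L \<noteq> {}" "L = f\<^sub>0 l ` L \<union> f\<^sub>1 l ` L"
  shows "K \<subseteq> L"
proof -
  have "continuous_on K (\<lambda>y. infdist y L)"
    by (intro continuous_on_infdist continuous_on_id)
  then obtain x where x: "x \<in> K" and mx: "\<And>y. y \<in> K \<Longrightarrow> infdist y L \<le> infdist x L"
    using continuous_attains_sup[OF K(1,2), of "\<lambda>y. infdist y L"]
    by blast
  obtain u f where u: "u \<in> K" "x = f u" and f: "f = f\<^sub>0 l \<or> f = f\<^sub>1 l"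
    using x K(3) by blast
  obtain v where v: "v \<in> L" "infdist u L = dist u v"
    using infdist_attains_inf[OF compact_imp_closed[OF L(1)] L(2)] by metis
  have fv: "f v \<in> L" using f v(1) L(3) by blast
  have "infdist x L \<le> dist (f u) (f v)" using infdist_le[OF fv] u by simp
  also have "\<dots> = l * dist u v"
    using f l by (auto simp: f\<^sub>0_def f\<^sub>1_def dist_real_def abs_mult simp flip: right_diff_distrib)
  also have "\<dots> \<le> l * infdist x L" using mx[OF u(1)] v l by simp
  finally have "(1 - l) * infdist x L \<le> 0" by (simp add: algebra_simps)
  then have "infdist x L \<le> 0" using l by (simp add: mult_le_0_iff)
  then have "infdist y L = 0" if "y \<in> K" for y
    using mx[OF that] infdist_nonneg[of y L] by linarith
  then show ?thesis
    using in_closed_iff_infdist_zero[OF compact_imp_closed[OF L(1)] L(2)] by blast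
qed

lemma cantor_set_ex1:
  assumes l: "0 < l" "l < 1/2"
  shows "\<exists>!K. compact K \<and> K \<noteq> {} \<and> K = f\<^sub>0 l ` K \<union> f\<^sub>1 l ` K"
proof -
  define F where "F A = f\<^sub>0 l ` A \<union> f\<^sub>1 l ` A" for A
  define A where "A n = (F ^^ n) {0..1}" for n
  define K where "K = (\<Inter>n. A n)"
  have ASuc: "A (Suc n) = F (A n)" for n by (simp add: A_def)
  have A0: "A 0 = {0..1}" by (simp add: A_def)
  have Fmono: "F B \<subseteq> F C" if "B \<subseteq> C" for B C using that by (auto simp: F_def)
  have F01: "F {0..1} \<subseteq> {0..1}"
  proof
    fix x assume "x \<in> F {0..1}"
    then obtain t where t: "0 \<le> t" "t \<le> 1" "x = l * t \<or> x = l * t + 1 - l"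
      by (auto simp: F_def f\<^sub>0_def f\<^sub>1_def)
    have "0 \<le> l * t" "l * t \<le> l" using t l by (auto simp: mult_left_le)
    then show "x \<in> {0..1}" using t(3) l unfolding atLeastAtMost_iff by linarith
  qed
  have step: "A (Suc n) \<subseteq> A n" for n
    by (induction n) (use F01 A0 ASuc Fmono in auto)
  have anti: "A n \<subseteq> A m" if "m \<le> n" for m n
    using lift_Suc_antimono_le[of A, OF step that] .
  have comp: "compact (A n)" for n
  proof (induction n)
    case 0 show ?case by (simp add: A0)
  next
    case (Suc n)
    have "continuous_on (A n) (f\<^sub>0 l)" "continuous_on (A n) (f\<^sub>1 l)"
      unfolding f\<^sub>0_def[abs_def] f\<^sub>1_def[abs_def] by (intro continuous_intros)+
    then show ?case
      by (auto simp: ASuc F_def intro!: compact_Un compact_continuous_image Suc)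
  qed
  have zero: "0 \<in> A n" for n
  proof (induction n)
    case (Suc n)
    have "f\<^sub>0 l 0 = 0" by (simp add: f\<^sub>0_def)
    then show ?case using Suc by (force simp: ASuc F_def)
  qed (simp add: A0)
  have "compact K"
    unfolding K_def by (rule compact_Inter) (use comp in auto)
  moreover have "K \<noteq> {}" using zero by (auto simp: K_def)
  moreover have "K = F K"
  proof
    have "F K \<subseteq> A (Suc n)" for n
      unfolding ASuc by (rule Fmono) (auto simp: K_def)
    then have "F K \<subseteq> A n" for n using step by blast
    then show "F K \<subseteq> K" by (auto simp: K_def)
  next
    have inj: "inj (f\<^sub>0 l)" "inj (f\<^sub>1 l)" using l by (auto simp: inj_def f\<^sub>0_def f\<^sub>1_def)
    show "K \<subseteq> F K"
    proof
      fix x assume x: "x \<in> K"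
      show "x \<in> F K"
      proof (rule ccontr)
        assume "x \<notin> F K"
        then have "x \<notin> (\<Inter>n. f\<^sub>0 l ` A n)" "x \<notin> (\<Inter>n. f\<^sub>1 l ` A n)"
          using image_INT[of "f\<^sub>0 l" UNIV UNIV A 0] image_INT[of "f\<^sub>1 l" UNIV UNIV A 0] inj
          by (auto simp: F_def K_def)
        then obtain m n where "x \<notin> f\<^sub>0 l ` A m" "x \<notin> f\<^sub>1 l ` A n" by blast
        then have "x \<notin> F (A (max m n))"
          using anti[of m "max m n"] anti[of n "max m n"] by (auto simp: F_def)
        then have "x \<notin> A (Suc (max m n))" by (simp add: ASuc)
        then show False using x by (auto simp: K_def)
      qed
    qed
  qed
  ultimately have KK: "compact K \<and> K \<noteq> {} \<and> K = f\<^sub>0 l ` K \<union> f\<^sub>1 l ` K" by (simp add: F_def)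
  then show ?thesis
  proof (rule ex1I)
    fix L assume L: "compact L \<and> L \<noteq> {} \<and> L = f\<^sub>0 l ` L \<union> f\<^sub>1 l ` L"
    show "L = K"
    proof (rule subset_antisym)
      show "L \<subseteq> K" by (rule invariant_subset[OF l]) (use L KK in blast)+
      show "K \<subseteq> L" by (rule invariant_subset[OF l]) (use L KK in blast)+
    qed
  qed
qed

end

(* Near the corner (0,1), a point (x, 1 - z) of the circle satisfies x^2 = 2z - z^2. Choose the
   endpoints x = (1 - l) l^n and z = l^(2n+1), for which x and 1 - z lie in the Cantor set. The
   circle equation becomes (1 - l)^2 = 2l - l^(2n+2). Without the last term its root in (0,1/2) is
   2 - sqrt 3, and the term l^(2n+2) moves the root to the right by an amount that decreases to 0
   as n grows. *)
theory Submission
  imports Defs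
begin

lemma cantor_set_props:
  assumes "0 < l" "l < 1/2"
  shows "compact (cantor_set l) \<and> cantor_set l \<noteq> {} \<and>
    cantor_set l = f\<^sub>0 l ` cantor_set l \<union> f\<^sub>1 l ` cantor_set l"
  unfolding cantor_set_def by (rule theI'[OF cantor_set_ex1[OF assms]])

lemma cantor_set_f0:
  assumes "0 < l" "l < 1/2" "x \<in> cantor_set l"
  shows "l * x \<in> cantor_set l"
  using cantor_set_props[OF assms(1,2)] assms(3) unfolding f\<^sub>0_def by blast

text \<open>Measured by the distance from its fixed point 1, \<open>f\<^sub>1 l\<close> is
  multiplication by \<open>l\<close>. Hence the form \<open>1 - x\<close>, which makes iteration
  produce plain powers of \<open>l\<close>.\<close>

lemma cantor_set_f1:
  assumes "0 < l" "l < 1/2" "1 - x \<in> cantor_set l"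
  shows "1 - l * x \<in> cantor_set l"
proof -
  have "f\<^sub>1 l (1 - x) \<in> cantor_set l"
    using cantor_set_props[OF assms(1,2)] assms(3) by blast
  then show ?thesis by (simp add: f\<^sub>1_def algebra_simps)
qed

lemma cantor_set_power_f0:
  assumes "0 < l" "l < 1/2" "x \<in> cantor_set l"
  shows "l ^ n * x \<in> cantor_set l"
  by (induction n) (use assms cantor_set_f0[OF assms(1,2)] in \<open>auto simp: mult.assoc\<close>)

lemma cantor_set_power_f1:
  assumes "0 < l" "l < 1/2" "1 - x \<in> cantor_set l"
  shows "1 - l ^ n * x \<in> cantor_set l"
  by (induction n) (use assms cantor_set_f1[OF assms(1,2)] in \<open>auto simp: mult.assoc\<close>)

text \<open>The fixed points 0 and 1 of the two contractions are limits of the orbits of any point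
  of the set, and the set is closed.\<close>

lemma cantor_set_0_1:
  assumes l: "0 < l" "l < 1/2"
  shows "0 \<in> cantor_set l" "1 \<in> cantor_set l"
proof -
  have cl: "closed (cantor_set l)"
    using cantor_set_props[OF l] compact_imp_closed by blast
  obtain x where x: "x \<in> cantor_set l" using cantor_set_props[OF l] by blast
  have lim: "(\<lambda>n. l ^ n) \<longlonglongrightarrow> 0" using l by (intro LIMSEQ_realpow_zero) auto
  have "(\<lambda>n. l ^ n * x) \<longlonglongrightarrow> 0" using tendsto_mult_left_zero[OF lim] .
  then show "0 \<in> cantor_set l"
    using closed_sequentially[OF cl, of "\<lambda>n. l ^ n * x"] cantor_set_power_f0[OF l x] by blast
  have "(\<lambda>n. 1 - l ^ n * (1 - x)) \<longlonglongrightarrow> 1 - 0"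
    by (intro tendsto_diff tendsto_const tendsto_mult_left_zero[OF lim])
  then show "1 \<in> cantor_set l"
    using closed_sequentially[OF cl, of "\<lambda>n. 1 - l ^ n * (1 - x)"]
      cantor_set_power_f1[OF l, of "1 - x"] x by simp
qed

lemma nontrivial_intersectionI:
  assumes l: "0 < l" "l < 1/2"
    and eq: "1 - 4 * l + l\<^sup>2 + l ^ (2 * n + 2) = 0"
  shows "\<not> trivial_intersection l"
proof -
  \<comment> \<open>In terms of the maps, \<open>x\<close> is the image of 0 under
    \<open>f\<^sub>1 l\<close> and then \<open>n\<close> times \<open>f\<^sub>0 l\<close>, and
    \<open>y\<close> is the image of 0 under \<open>2 * n + 1\<close> times
    \<open>f\<^sub>1 l\<close>.\<close>
  define x y where "x = l ^ n * (1 - l)" and "y = 1 - l ^ (2 * n + 1)"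
  have "x \<in> cantor_set l"
    unfolding x_def using cantor_set_f1[OF l, of 1] cantor_set_0_1[OF l]
    by (intro cantor_set_power_f0[OF l]) simp
  moreover have "y \<in> cantor_set l"
    unfolding y_def using cantor_set_power_f1[OF l, of 1 "2 * n + 1"] cantor_set_0_1[OF l] by simp
  moreover have "x\<^sup>2 + y\<^sup>2 = 1"
  proof -
    define p where "p = l ^ n"
    have "1 - 4 * l + l\<^sup>2 + p\<^sup>2 * l\<^sup>2 = 0"
      using eq unfolding p_def power_add power_even_eq .
    moreover have "x = p * (1 - l)" "y = 1 - p\<^sup>2 * l"
      by (simp_all add: x_def y_def p_def power_mult[symmetric] mult.commute)
    moreover have "(p * (1 - l))\<^sup>2 + (1 - p\<^sup>2 * l)\<^sup>2 - 1 = p\<^sup>2 * (1 - 4 * l + l\<^sup>2 + p\<^sup>2 * l\<^sup>2)"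
      by (simp add: power2_eq_square algebra_simps)
    ultimately show ?thesis by simp
  qed
  \<comment> \<open>A nonzero \<open>x\<close> rules out (0,1) and a nonzero \<open>y\<close> rules
    out (1,0).\<close>
  moreover have "x \<noteq> 0" using l by (simp add: x_def)
  moreover have "y \<noteq> 0"
    using l power_Suc_less_one[of l "2 * n"] by (simp add: y_def)
  ultimately show ?thesis
    unfolding trivial_intersection_def unit_circle_def by blast
qed

text \<open>Powers are 1-Lipschitz on [0,1/2]. In the induction step, b^(k+2) - a^(k+2) = b (b^(k+1)
  - a^(k+1)) + a^(k+1) (b - a), and each summand is at most half of b - a.\<close>

lemma power_diff_le_diff:
  fixes a b :: real
  assumes "0 \<le> a" "a \<le> b" "b \<le> 1/2"
  shows "b ^ Suc k - a ^ Suc k \<le> b - a"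
proof (induction k)
  case (Suc k)
  have "b * (b ^ Suc k - a ^ Suc k) \<le> 1/2 * (b - a)"
    using Suc assms by (intro mult_mono) (auto intro!: mult_mono power_mono)
  moreover have "a ^ Suc k \<le> (1/2) ^ Suc 0"
    using power_mono[of a "1/2" "Suc k"] power_decreasing[of "Suc 0" "Suc k" "1/2 :: real"] assms
    by simp
  then have "a ^ Suc k * (b - a) \<le> 1/2 * (b - a)"
    using assms by (intro mult_right_mono) auto
  ultimately show ?case by (simp add: algebra_simps)
qed simp

lemma root_exists:
  "\<exists>l. 2 - sqrt 3 < l \<and> l < 1/2 \<and> 1 - 4 * l + l\<^sup>2 + l ^ (2 * n + 2) = 0"
proof -
  define g where "g l = 1 - 4 * l + l\<^sup>2 + l ^ (2 * n + 2)" for l :: real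
  have s: "3/2 < sqrt 3" by (rule real_less_rsqrt) (simp add: power2_eq_square)
  have s': "sqrt 3 < 2" by (intro real_less_lsqrt) auto
  \<comment> \<open>The quadratic part vanishes at 2 - sqrt 3, which leaves a positive power. At 1/2
    it equals -3/4, while the power is at most 1/4.\<close>
  have "g (2 - sqrt 3) = (2 - sqrt 3) ^ (2 * n + 2)"
    by (simp add: g_def power2_diff)
  then have pos: "0 < g (2 - sqrt 3)" using s' by simp
  have "(1/2 :: real) ^ (2 * n + 2) \<le> (1/2) ^ 2"
    by (intro power_decreasing) auto
  then have neg: "g (1/2) < 0" by (simp add: g_def power2_eq_square)
  have "\<exists>l\<ge>2 - sqrt 3. l \<le> 1/2 \<and> g l = 0"
    using s pos neg by (intro IVT2') (auto simp: g_def intro!: continuous_intros)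
  then obtain l where "2 - sqrt 3 \<le> l" "l \<le> 1/2" "g l = 0" by blast
  moreover have "l \<noteq> 2 - sqrt 3" "l \<noteq> 1/2" using pos neg \<open>g l = 0\<close> by force+
  ultimately show ?thesis unfolding g_def by (intro exI[of _ l]) simp
qed

text \<open>If a <= b, subtracting the two equations gives (b - a)(4 - a - b) = b^(2n+2) - a^(2m+2).
  The larger exponent and the Lipschitz bound make the right side smaller than b - a, but 4 - a - b
  >= 1.\<close>

lemma root_strict_antimono:
  fixes a b :: real
  assumes a: "0 < a" "1 - 4 * a + a\<^sup>2 + a ^ (2 * m + 2) = 0"
    and b: "b < 1/2" "1 - 4 * b + b\<^sup>2 + b ^ (2 * n + 2) = 0"
    and "m < n"
  shows "b < a"
proof (rule ccontr)
  assume "\<not> b < a"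
  then have ab: "a \<le> b" by simp
  have "b ^ (2 * n + 2) < b ^ (2 * m + 2)"
    using a b ab \<open>m < n\<close> by (intro power_strict_decreasing) auto
  moreover have "b ^ (2 * m + 2) - a ^ (2 * m + 2) \<le> b - a"
    using power_diff_le_diff[of a b "2 * m + 1"] a b ab by simp
  moreover have "(b - a) * (4 - a - b) = b ^ (2 * n + 2) - a ^ (2 * m + 2)"
    using a(2) b(2) by (simp add: power2_eq_square algebra_simps)
  ultimately have "(b - a) * (4 - a - b) < b - a" by linarith
  moreover have "(b - a) * 1 \<le> (b - a) * (4 - a - b)"
    using ab b(1) by (intro mult_left_mono) auto
  ultimately show False by simp
qed

lemma root_upper_bound:
  fixes l :: real
  assumes l: "2 - sqrt 3 < l" "l < 1/2" "1 - 4 * l + l\<^sup>2 + l ^ (2 * n + 2) = 0"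
  shows "l \<le> 2 - sqrt 3 + (1/4) ^ n"
proof -
  have s: "sqrt 3 < 2" by (intro real_less_lsqrt) auto
  \<comment> \<open>The quadratic has the roots 2 - sqrt 3 and 2 + sqrt 3. The factor belonging to
    the second is at least 1, so the distance from \<open>l\<close> to the first is at most the
    power of \<open>l\<close>.\<close>
  have "(l - (2 - sqrt 3)) * 1 \<le> (l - (2 - sqrt 3)) * (2 + sqrt 3 - l)"
    using l by (intro mult_left_mono) (auto intro: add_increasing2)
  also have "\<dots> = 4 * l - l\<^sup>2 - 1"
    by (simp add: power2_eq_square algebra_simps)
  also have "\<dots> = l ^ (2 * n + 2)"
    using l(3) by simp
  also have "\<dots> \<le> (1/2) ^ (2 * n + 2)"
    using l s by (intro power_mono) auto
  also have "\<dots> \<le> (1/2) ^ (2 * n)"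
    by (intro power_decreasing) auto
  also have "\<dots> = (1/4) ^ n"
    by (simp add: power_mult power2_eq_square)
  finally show ?thesis by simp
qed

theorem mainTheorem2:
  shows "\<exists>lam :: nat \<Rightarrow> real.
    (\<forall>n\<ge>1. lam n \<in> {0<..<1/2}) \<and>
    strict_antimono_on {1..} lam \<and>
    lam \<longlonglongrightarrow> 2 - sqrt 3 \<and>
    (\<forall>n\<ge>1. \<not> trivial_intersection (lam n))"
proof -
  \<comment> \<open>Any choice of one root for each \<open>n\<close> will do: the comparison of
    roots and the bound on them hold for all roots in the interval.\<close>
  obtain lam :: "nat \<Rightarrow> real" where lam: "\<And>n. 2 - sqrt 3 < lam n" "\<And>n. lam n < 1/2"
    "\<And>n. 1 - 4 * lam n + (lam n)\<^sup>2 + lam n ^ (2 * n + 2) = 0"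
    using root_exists by metis
  have "sqrt 3 < 2" by (intro real_less_lsqrt) auto
  then have pos: "0 < lam n" for n using lam(1)[of n] by linarith
  have "strict_antimono_on {1..} lam"
    using root_strict_antimono[OF pos lam(3) lam(2) lam(3)] by (intro monotone_onI) auto
  moreover have "lam \<longlonglongrightarrow> 2 - sqrt 3"
  proof (rule tendsto_sandwich[of "\<lambda>_. 2 - sqrt 3" _ _ "\<lambda>n. 2 - sqrt 3 + (1/4) ^ n"])
    have "(\<lambda>n. 2 - sqrt 3 + (1/4) ^ n) \<longlonglongrightarrow> 2 - sqrt 3 + 0"
      by (intro tendsto_add tendsto_const LIMSEQ_realpow_zero) auto
    then show "(\<lambda>n. 2 - sqrt 3 + (1/4) ^ n) \<longlonglongrightarrow> 2 - sqrt 3" by simp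
  qed (use lam(1) root_upper_bound[OF lam] in \<open>auto intro!: always_eventually less_imp_le\<close>)
  ultimately show ?thesis
    using pos lam(2) nontrivial_intersectionI[OF pos lam(2) lam(3)]
    by (intro exI[of _ lam]) auto
qed

end
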